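(* Fix integers $v\ge 0$, $d\ge 0$. Let $A,B\in\mathbf{K}[\![v,d]\!]$ be characteristic minmatrices, and order $\mathbf{K}[\![v,d]\!]$ by set inclusion. Then: (a) $A\cup B\in\mathbf{K}[\![v,d]\!]$; consequently the least upper bound of $A$ and $B$ in $\mathbf{K}[\![v,d]\!]$ is $A\vee B=A\cup B$; (b) the greatest lower bound $A\wedge B$ of $A$ and $B$ in $\mathbf{K}[\![v,d]\!]$ satisfies $A\wedge B\subseteq A\cap B$.
   Context: Formulas are unimodal propositional formulas built from variables $p_0,\dots,p_{v-1}$, constants $0,1$, Boolean connectives and $\Diamond$ (with $\Box=\neg\Diamond\neg$); the modal degree is the maximal nesting depth of modal operators. $\mathbf{K}$ is the least normal modal logic, and a normal modal logic (system) is any normal extension of $\mathbf{K}$; $\mathbf{F}$ denotes the inconsistent logic (all formulas). $\mathbf{K}[v,d]$ is the Lindenbaum–Tarski algebra of formulas in the variables $p_0,\dots,p_{v-1}$ of modal degree $\le d$ modulo $\mathbf{K}$-provable equivalence; it is a finite Boolean algebra. Its atoms ("minterms") are: for $d=0$, the $2^v$ conjunctions $\bigwedge_i \pm p_i$; for level $d+1$, all conjunctions $m\wedge\bigwedge_{\mu}\pm\Diamond\mu$ where $m$ is a level-0 minterm and $\mu$ ranges over all level-$d$ minterms (every choice of signs). Each element $\varphi$ is identified with the set $[\varphi]$ of minterms below it, so that $\mathbf{K}\vdash\varphi\to\psi$ iff $[\varphi]\subseteq[\psi]$. For a normal modal logic $\mathbf{S}$, its characteristic minmatrix (CMM) in $\mathbf{K}[v,d]$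 is $[\![\mathbf{S}]\!]=\bigcap\{[\varphi]:\varphi\in\mathbf{K}[v,d],\ \mathbf{S}\vdash\varphi\}$ (the class of the conjunction of all $\mathbf{S}$-theorems of $\mathbf{K}[v,d]$). $\mathbf{K}[\![v,d]\!]$ is the set of all CMMs $[\![\mathbf{S}]\!]$ in $\mathbf{K}[v,d]$ as $\mathbf{S}$ ranges over normal modal logics (it contains $[\![\mathbf{F}]\!]=\emptyset$ and $[\![\mathbf{K}]\!]$ = all minterms). *)

theory Defs
  imports "HOL-Library.Lub_Glb"
begin

datatype fm =
    Var nat
  | Bot
  | Top
  | Neg fm
  | Conj fm fm
  | Disj fm fm
  | Imp fm fm
  | Dia fm

definition Iff :: "fm \<Rightarrow> fm \<Rightarrow> fm" where
  "Iff \<phi> \<psi> = Conj (Imp \<phi> \<psi>) (Imp \<psi> \<phi>)"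

definition Box :: "fm \<Rightarrow> fm" where
  "Box \<phi> = Neg (Dia (Neg \<phi>))"

primrec vars :: "fm \<Rightarrow> nat set" where
  "vars (Var i) = {i}"
| "vars Bot = {}"
| "vars Top = {}"
| "vars (Neg \<phi>) = vars \<phi>"
| "vars (Conj \<phi> \<psi>) = vars \<phi> \<union> vars \<psi>"
| "vars (Disj \<phi> \<psi>) = vars \<phi> \<union> vars \<psi>"
| "vars (Imp \<phi> \<psi>) = vars \<phi> \<union> vars \<psi>"
| "vars (Dia \<phi>) = vars \<phi>"

primrec modal_degree :: "fm \<Rightarrow> nat" where
  "modal_degree (Var i) = 0"
| "modal_degree Bot = 0"
| "modal_degree Top = 0"
| "modal_degree (Neg \<phi>) = modal_degree \<phi>"
| "modal_degree (Conj \<phi> \<psi>) = max (modal_degree \<phi>) (modal_degree \<psi>)"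
| "modal_degree (Disj \<phi> \<psi>) = max (modal_degree \<phi>) (modal_degree \<psi>)"
| "modal_degree (Imp \<phi> \<psi>) = max (modal_degree \<phi>) (modal_degree \<psi>)"
| "modal_degree (Dia \<phi>) = Suc (modal_degree \<phi>)"

primrec subst :: "(nat \<Rightarrow> fm) \<Rightarrow> fm \<Rightarrow> fm" where
  "subst \<sigma> (Var i) = \<sigma> i"
| "subst \<sigma> Bot = Bot"
| "subst \<sigma> Top = Top"
| "subst \<sigma> (Neg \<phi>) = Neg (subst \<sigma> \<phi>)"
| "subst \<sigma> (Conj \<phi> \<psi>) = Conj (subst \<sigma> \<phi>) (subst \<sigma> \<psi>)"
| "subst \<sigma> (Disj \<phi> \<psi>) = Disj (subst \<sigma> \<phi>) (subst \<sigma> \<psi>)"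
| "subst \<sigma> (Imp \<phi> \<psi>) = Imp (subst \<sigma> \<phi>) (subst \<sigma> \<psi>)"
| "subst \<sigma> (Dia \<phi>) = Dia (subst \<sigma> \<phi>)"

text \<open>Boolean evaluation in which formulas \<^term>\<open>Dia \<phi>\<close> count as propositional atoms:
  \<open>P\<close> values the variables and \<open>Q \<phi>\<close> is the value given to \<^term>\<open>Dia \<phi>\<close>.\<close>

primrec eval_prop :: "(nat \<Rightarrow> bool) \<Rightarrow> (fm \<Rightarrow> bool) \<Rightarrow> fm \<Rightarrow> bool" where
  "eval_prop P Q (Var i) = P i"
| "eval_prop P Q Bot = False"
| "eval_prop P Q Top = True"
| "eval_prop P Q (Neg \<phi>) = (\<not> eval_prop P Q \<phi>)"
| "eval_prop P Q (Conj \<phi> \<psi>) = (eval_prop P Q \<phi> \<and> eval_prop P Q \<psi>)"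
| "eval_prop P Q (Disj \<phi> \<psi>) = (eval_prop P Q \<phi> \<or> eval_prop P Q \<psi>)"
| "eval_prop P Q (Imp \<phi> \<psi>) = (eval_prop P Q \<phi> \<longrightarrow> eval_prop P Q \<psi>)"
| "eval_prop P Q (Dia \<phi>) = Q \<phi>"

definition tautology :: "fm \<Rightarrow> bool" where
  "tautology \<phi> \<longleftrightarrow> (\<forall>P Q. eval_prop P Q \<phi>)"

text \<open>Since \<^const>\<open>Dia\<close> is primitive and \<^const>\<open>Box\<close> is defined, the duality axiom is not
  redundant: distribution and necessitation alone say nothing about \<^const>\<open>Dia\<close> applied to
  formulas that are not negations.\<close>

definition normal_logic :: "fm set \<Rightarrow> bool" where
  "normal_logic L \<longleftrightarrow>
     (\<forall>\<phi>. tautology \<phi> \<longrightarrow> \<phi> \<in> L) \<and>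
     Imp (Box (Imp (Var 0) (Var 1))) (Imp (Box (Var 0)) (Box (Var 1))) \<in> L \<and>
     Iff (Dia (Var 0)) (Neg (Box (Neg (Var 0)))) \<in> L \<and>
     (\<forall>\<phi> \<psi>. Imp \<phi> \<psi> \<in> L \<longrightarrow> \<phi> \<in> L \<longrightarrow> \<psi> \<in> L) \<and>
     (\<forall>\<phi> \<sigma>. \<phi> \<in> L \<longrightarrow> subst \<sigma> \<phi> \<in> L) \<and>
     (\<forall>\<phi>. \<phi> \<in> L \<longrightarrow> Box \<phi> \<in> L)"

definition logic_K :: "fm set" where
  "logic_K = \<Inter> {L. normal_logic L}"

lemma normal_logic_K: "normal_logic logic_K"
  unfolding logic_K_def normal_logic_def by blast

lemma logic_K_least: "normal_logic L \<Longrightarrow> logic_K \<subseteq> L"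
  unfolding logic_K_def by blast

lemma normal_logic_UNIV: "normal_logic UNIV"
  by (simp add: normal_logic_def)

definition forms :: "nat \<Rightarrow> nat \<Rightarrow> fm set" where
  "forms v d = {\<phi>. vars \<phi> \<subseteq> {..<v} \<and> modal_degree \<phi> \<le> d}"

definition K_equiv :: "nat \<Rightarrow> nat \<Rightarrow> (fm \<times> fm) set" where
  "K_equiv v d = {(\<phi>, \<psi>). \<phi> \<in> forms v d \<and> \<psi> \<in> forms v d \<and> Iff \<phi> \<psi> \<in> logic_K}"

definition K_alg :: "nat \<Rightarrow> nat \<Rightarrow> fm set set" where
  "K_alg v d = forms v d // K_equiv v d"

definition K_le :: "fm set \<Rightarrow> fm set \<Rightarrow> bool" where
  "K_le X Y \<longleftrightarrow> (\<forall>\<phi>\<in>X. \<forall>\<psi>\<in>Y. Imp \<phi> \<psi> \<in> logic_K)"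

definition conj_list :: "fm list \<Rightarrow> fm" where
  "conj_list \<phi>s = foldr Conj \<phi>s Top"

text \<open>All conjunctions of the formulas in \<open>\<phi>s\<close>, each taken with an arbitrary sign.\<close>

definition signed_conjs :: "fm list \<Rightarrow> fm list" where
  "signed_conjs \<phi>s = map conj_list (product_lists (map (\<lambda>\<phi>. [\<phi>, Neg \<phi>]) \<phi>s))"

primrec minterm_fms :: "nat \<Rightarrow> nat \<Rightarrow> fm list" where
  "minterm_fms v 0 = signed_conjs (map Var [0..<v])"
| "minterm_fms v (Suc d) =
     [Conj m c. m \<leftarrow> signed_conjs (map Var [0..<v]),
                c \<leftarrow> signed_conjs (map Dia (minterm_fms v d))]"

definition minterms :: "nat \<Rightarrow> nat \<Rightarrow> fm set set" where
  "minterms v d = set (minterm_fms v d) // K_equiv v d"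

definition minterms_below :: "nat \<Rightarrow> nat \<Rightarrow> fm set \<Rightarrow> fm set set" where
  "minterms_below v d X = {M \<in> minterms v d. K_le M X}"

text \<open>A normal logic is closed under \<^const>\<open>logic_K\<close>-provable equivalence, so a class \<open>X\<close>
  is contained in \<open>S\<close> as soon as one of its representatives is an \<open>S\<close>-theorem.\<close>

definition CMM :: "nat \<Rightarrow> nat \<Rightarrow> fm set \<Rightarrow> fm set set" where
  "CMM v d S = \<Inter> {minterms_below v d X | X. X \<in> K_alg v d \<and> X \<subseteq> S}"

definition CMMs :: "nat \<Rightarrow> nat \<Rightarrow> fm set set set" where
  "CMMs v d = {CMM v d S | S. normal_logic S}"

end

theory Submission
  imports Defs
begin

text \<open>Every minterm of level \<open>d\<close> decides every formula of degree at most \<open>d\<close>, hence is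
  prime: if it lies below \<open>\<phi> \<or> \<psi>\<close>, it lies below \<open>\<phi>\<close> or below \<open>\<psi>\<close>. Since \<open>\<phi> \<or> \<psi>\<close> is a
  theorem of \<open>S \<inter> T\<close> whenever \<open>\<phi>\<close> is one of \<open>S\<close> and \<open>\<psi>\<close> one of \<open>T\<close>, the minmatrix of
  \<open>S \<inter> T\<close> is the union of those of \<open>S\<close> and \<open>T\<close>. The family of minmatrices is therefore a
  finite join-semilattice with a least element, so the union of all common lower bounds of
  \<open>A\<close> and \<open>B\<close> is again a minmatrix, and it is their meet.\<close>

section \<open>Normal logics\<close>

lemma normal_logic_taut: "normal_logic L \<Longrightarrow> tautology \<phi> \<Longrightarrow> \<phi> \<in> L"
  by (simp add: normal_logic_def)

lemma normal_logic_mp: "normal_logic L \<Longrightarrow> Imp \<phi> \<psi> \<in> L \<Longrightarrow> \<phi> \<in> L \<Longrightarrow> \<psi> \<in> L"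
  unfolding normal_logic_def by blast

lemma normal_logic_subst: "normal_logic L \<Longrightarrow> \<phi> \<in> L \<Longrightarrow> subst \<sigma> \<phi> \<in> L"
  unfolding normal_logic_def by blast

lemma normal_logic_nec: "normal_logic L \<Longrightarrow> \<phi> \<in> L \<Longrightarrow> Box \<phi> \<in> L"
  unfolding normal_logic_def by blast

text \<open>This rule and the next two reduce propositional reasoning inside a logic to a
  truth-table check in which diamonds are uninterpreted atoms.\<close>

lemma normal_logic_taut1:
  assumes "normal_logic L" "\<phi> \<in> L" "tautology (Imp \<phi> \<psi>)"
  shows "\<psi> \<in> L"
  using assms normal_logic_mp normal_logic_taut by blast

lemma normal_logic_taut2:
  assumes "normal_logic L" "\<phi> \<in> L" "\<psi> \<in> L" "tautology (Imp \<phi> (Imp \<psi> \<chi>))"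
  shows "\<chi> \<in> L"
  using assms normal_logic_mp normal_logic_taut by blast

lemma normal_logic_taut3:
  assumes "normal_logic L" "\<phi> \<in> L" "\<psi> \<in> L" "\<chi> \<in> L" "tautology (Imp \<phi> (Imp \<psi> (Imp \<chi> \<theta>)))"
  shows "\<theta> \<in> L"
  using assms normal_logic_mp normal_logic_taut by blast

lemma normal_logic_Box_Imp:
  assumes "normal_logic L"
  shows "Imp (Box (Imp \<phi> \<psi>)) (Imp (Box \<phi>) (Box \<psi>)) \<in> L"
proof -
  have "Imp (Box (Imp (Var 0) (Var 1))) (Imp (Box (Var 0)) (Box (Var 1))) \<in> L"
    using assms unfolding normal_logic_def by blast
  from normal_logic_subst[OF assms this, of "\<lambda>i. if i = 0 then \<phi> else \<psi>"]
  show ?thesis by (simp add: Box_def)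
qed

lemma normal_logic_Dia_dual:
  assumes "normal_logic L"
  shows "Iff (Dia \<phi>) (Neg (Box (Neg \<phi>))) \<in> L"
proof -
  have "Iff (Dia (Var 0)) (Neg (Box (Neg (Var 0)))) \<in> L"
    using assms unfolding normal_logic_def by blast
  from normal_logic_subst[OF assms this, of "\<lambda>i. \<phi>"]
  show ?thesis by (simp add: Box_def Iff_def)
qed

lemma normal_logic_Box_mono:
  assumes "normal_logic L" "Imp \<phi> \<psi> \<in> L"
  shows "Imp (Box \<phi>) (Box \<psi>) \<in> L"
  using assms normal_logic_Box_Imp normal_logic_mp normal_logic_nec by blast

text \<open>Contrapose, apply monotonicity of \<open>Box\<close>, and translate back by
  duality.\<close>

lemma normal_logic_Dia_mono:
  assumes L: "normal_logic L" and "Imp \<phi> \<psi> \<in> L"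
  shows "Imp (Dia \<phi>) (Dia \<psi>) \<in> L"
proof -
  have imp: "Imp (Neg \<psi>) (Neg \<phi>) \<in> L"
    by (rule normal_logic_taut1[OF assms]) (auto simp: tautology_def)
  show ?thesis
    by (rule normal_logic_taut3[OF L normal_logic_Box_mono[OF L imp]
      normal_logic_Dia_dual[OF L, of \<phi>] normal_logic_Dia_dual[OF L, of \<psi>]])
      (auto simp: tautology_def Iff_def Box_def)
qed

lemma normal_logic_not_Dia_Bot:
  assumes L: "normal_logic L"
  shows "Neg (Dia Bot) \<in> L"
proof -
  have box: "Box (Neg Bot) \<in> L"
    by (intro normal_logic_nec normal_logic_taut L) (simp add: tautology_def)
  show ?thesis
    by (rule normal_logic_taut2[OF L box normal_logic_Dia_dual[OF L, of Bot]])
      (auto simp: tautology_def Iff_def Box_def)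
qed

text \<open>Dual to \<open>Box\<close> distributing over conjunction: if both disjuncts are
  necessarily false, so is the disjunction.\<close>

lemma normal_logic_Dia_Disj:
  assumes L: "normal_logic L"
  shows "Imp (Dia (Disj \<phi> \<psi>)) (Disj (Dia \<phi>) (Dia \<psi>)) \<in> L"
proof -
  let ?n = "Neg (Disj \<phi> \<psi>)"
  have "Imp (Neg \<phi>) (Imp (Neg \<psi>) ?n) \<in> L"
    by (intro normal_logic_taut L) (simp add: tautology_def)
  note box = normal_logic_Box_mono[OF L this]
  have imp: "Imp (Box (Neg \<phi>)) (Imp (Box (Neg \<psi>)) (Box ?n)) \<in> L"
    by (rule normal_logic_taut2[OF L box normal_logic_Box_Imp[OF L, of "Neg \<psi>" ?n]])
      (auto simp: tautology_def Box_def)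
  have imp: "Imp (Dia (Disj \<phi> \<psi>)) (Disj (Neg (Box (Neg \<phi>))) (Neg (Box (Neg \<psi>)))) \<in> L"
    by (rule normal_logic_taut2[OF L imp normal_logic_Dia_dual[OF L, of "Disj \<phi> \<psi>"]])
      (auto simp: tautology_def Iff_def Box_def)
  show ?thesis
    by (rule normal_logic_taut3[OF L imp normal_logic_Dia_dual[OF L, of \<phi>]
      normal_logic_Dia_dual[OF L, of \<psi>]])
      (auto simp: tautology_def Iff_def Box_def)
qed

text \<open>Each clause of normality is a membership or closure condition, so it survives
  intersection. The logic \<open>S \<inter> T\<close> will realise the union of two
  minmatrices.\<close>

lemma normal_logic_Int: "normal_logic S \<Longrightarrow> normal_logic T \<Longrightarrow> normal_logic (S \<inter> T)"
  unfolding normal_logic_def by blast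

section \<open>Minterms decide formulas\<close>

definition disj_list :: "fm list \<Rightarrow> fm" where
  "disj_list \<phi>s = foldr Disj \<phi>s Bot"

lemma disj_list_simps [simp]:
  "disj_list [] = Bot"
  "disj_list (\<phi> # \<phi>s) = Disj \<phi> (disj_list \<phi>s)"
  by (simp_all add: disj_list_def)

lemma eval_prop_disj_list: "eval_prop P Q (disj_list \<phi>s) \<longleftrightarrow> (\<exists>\<phi>\<in>set \<phi>s. eval_prop P Q \<phi>)"
  by (induction \<phi>s) auto

lemma set_signed_conjs_Nil: "set (signed_conjs []) = {Top}"
  by (simp add: signed_conjs_def conj_list_def)

lemma set_signed_conjs_Cons:
  "set (signed_conjs (\<phi> # \<phi>s)) =
     Conj \<phi> ` set (signed_conjs \<phi>s) \<union> Conj (Neg \<phi>) ` set (signed_conjs \<phi>s)"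
  by (simp add: signed_conjs_def conj_list_def image_image)

text \<open>Give each entry the sign that matches its truth value.\<close>

lemma signed_conjs_exhaustive: "\<exists>m\<in>set (signed_conjs \<phi>s). eval_prop P Q m"
proof (induction \<phi>s)
  case Nil
  show ?case by (simp add: set_signed_conjs_Nil)
next
  case (Cons \<phi> \<phi>s)
  then show ?case by (cases "eval_prop P Q \<phi>") (auto simp: set_signed_conjs_Cons bex_Un)
qed

lemma signed_conjs_decide:
  "m \<in> set (signed_conjs \<phi>s) \<Longrightarrow> \<phi> \<in> set \<phi>s \<Longrightarrow>
     tautology (Imp m \<phi>) \<or> tautology (Imp m (Neg \<phi>))"
proof (induction \<phi>s arbitrary: m)
  case (Cons \<psi> \<phi>s)
  then show ?case by (fastforce simp: set_signed_conjs_Cons tautology_def)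
qed simp

text \<open>No induction on \<open>d\<close> is involved: diamonds are atoms for
  \<open>eval_prop\<close>, so exhaustiveness of sign choices suffices at each level.\<close>

lemma tautology_disj_minterms: "tautology (disj_list (minterm_fms v d))"
proof (cases d)
  case 0
  then show ?thesis
    by (simp add: tautology_def eval_prop_disj_list signed_conjs_exhaustive)
next
  case (Suc e)
  show ?thesis
    unfolding tautology_def
  proof (intro allI)
    fix P Q
    obtain m c where "m \<in> set (signed_conjs (map Var [0..<v]))" "eval_prop P Q m"
        "c \<in> set (signed_conjs (map Dia (minterm_fms v e)))" "eval_prop P Q c"
      using signed_conjs_exhaustive by meson
    then show "eval_prop P Q (disj_list (minterm_fms v d))"
      by (force simp: Suc eval_prop_disj_list)
  qed
qed

text \<open>Stated modulo \<open>logic_K\<close> rather than \<open>tautology\<close>, since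
  deciding a diamond uses modal reasoning inside its scope.\<close>

definition decides :: "fm \<Rightarrow> fm \<Rightarrow> bool" where
  "decides m \<phi> \<longleftrightarrow> Imp m \<phi> \<in> logic_K \<or> Imp m (Neg \<phi>) \<in> logic_K"

text \<open>Induction on the list: a disjunct that refutes \<open>\<phi>\<close> drops out under the
  diamond; for any other, the diamond is split over the disjunction and \<open>m\<close> excludes
  \<open>Dia \<mu>\<close>.\<close>

lemma not_Dia_Conj_disj_list:
  assumes "\<And>\<mu>. \<mu> \<in> set \<mu>s \<Longrightarrow> Imp \<mu> (Neg \<phi>) \<in> logic_K \<or> Imp m (Neg (Dia \<mu>)) \<in> logic_K"
  shows "Imp m (Neg (Dia (Conj \<phi> (disj_list \<mu>s)))) \<in> logic_K"
  using assms
proof (induction \<mu>s)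
  case Nil
  have imp: "Imp (Conj \<phi> Bot) Bot \<in> logic_K"
    by (intro normal_logic_taut normal_logic_K) (simp add: tautology_def)
  show ?case
    by (rule normal_logic_taut2[OF normal_logic_K normal_logic_Dia_mono[OF normal_logic_K imp]
      normal_logic_not_Dia_Bot[OF normal_logic_K]])
      (auto simp: tautology_def)
next
  case (Cons \<mu> \<mu>s)
  let ?D = "Conj \<phi> (disj_list \<mu>s)"
  let ?C = "Conj \<phi> (disj_list (\<mu> # \<mu>s))"
  have IH: "Imp m (Neg (Dia ?D)) \<in> logic_K"
    using Cons by simp
  consider "Imp \<mu> (Neg \<phi>) \<in> logic_K" | "Imp m (Neg (Dia \<mu>)) \<in> logic_K"
    using Cons.prems by auto
  then show ?case
  proof cases
    case 1
    have imp: "Imp ?C ?D \<in> logic_K"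
      by (rule normal_logic_taut1[OF normal_logic_K 1]) (auto simp: tautology_def)
    show ?thesis
      by (rule normal_logic_taut2[OF normal_logic_K normal_logic_Dia_mono[OF normal_logic_K imp] IH])
        (auto simp: tautology_def)
  next
    case 2
    have imp: "Imp ?C (Disj \<mu> ?D) \<in> logic_K"
      by (intro normal_logic_taut normal_logic_K) (auto simp: tautology_def)
    have imp: "Imp (Dia ?C) (Disj (Dia \<mu>) (Dia ?D)) \<in> logic_K"
      by (rule normal_logic_taut2[OF normal_logic_K normal_logic_Dia_mono[OF normal_logic_K imp]
          normal_logic_Dia_Disj[OF normal_logic_K]])
        (auto simp: tautology_def)
    show ?thesis
      by (rule normal_logic_taut3[OF normal_logic_K imp IH 2])
        (auto simp: tautology_def)
  qed
qed

text \<open>If some \<open>\<mu>\<close> implies \<open>\<phi>\<close> and \<open>m\<close> implies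
  \<open>Dia \<mu>\<close>, monotonicity gives \<open>Dia \<phi>\<close>. Otherwise each
  \<open>\<mu>\<close> refutes \<open>\<phi>\<close> or has its diamond refuted by \<open>m\<close>;
  as the \<open>\<mu>\<close> exhaust all cases, \<open>m\<close> refutes
  \<open>Dia \<phi>\<close>.\<close>

lemma decides_Dia:
  assumes exhaustive: "disj_list \<mu>s \<in> logic_K"
    and \<phi>: "\<And>\<mu>. \<mu> \<in> set \<mu>s \<Longrightarrow> decides \<mu> \<phi>"
    and m: "\<And>\<mu>. \<mu> \<in> set \<mu>s \<Longrightarrow> decides m (Dia \<mu>)"
  shows "decides m (Dia \<phi>)"
proof (cases "\<exists>\<mu>\<in>set \<mu>s. Imp \<mu> \<phi> \<in> logic_K \<and> Imp m (Dia \<mu>) \<in> logic_K")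
  case True
  then obtain \<mu> where \<mu>: "Imp \<mu> \<phi> \<in> logic_K" "Imp m (Dia \<mu>) \<in> logic_K"
    by blast
  have "Imp m (Dia \<phi>) \<in> logic_K"
    by (rule normal_logic_taut2[OF normal_logic_K normal_logic_Dia_mono[OF normal_logic_K \<mu>(1)] \<mu>(2)])
      (auto simp: tautology_def)
  then show ?thesis by (simp add: decides_def)
next
  case False
  then have *: "Imp m (Neg (Dia (Conj \<phi> (disj_list \<mu>s)))) \<in> logic_K"
    using \<phi> m by (intro not_Dia_Conj_disj_list) (auto simp: decides_def)
  have imp: "Imp \<phi> (Conj \<phi> (disj_list \<mu>s)) \<in> logic_K"
    by (rule normal_logic_taut1[OF normal_logic_K exhaustive]) (simp add: tautology_def)
  have "Imp m (Neg (Dia \<phi>)) \<in> logic_K"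
    by (rule normal_logic_taut2[OF normal_logic_K normal_logic_Dia_mono[OF normal_logic_K imp] *])
      (auto simp: tautology_def)
  then show ?thesis by (simp add: decides_def)
qed

section \<open>Decided formulas are closed under the Boolean connectives\<close>

lemma decides_Bot: "decides m Bot"
  unfolding decides_def
  by (intro disjI2 normal_logic_taut normal_logic_K) (simp add: tautology_def)

lemma decides_Top: "decides m Top"
  unfolding decides_def
  by (intro disjI1 normal_logic_taut normal_logic_K) (simp add: tautology_def)

lemma decides_Neg: "decides m \<phi> \<Longrightarrow> decides m (Neg \<phi>)"
  using normal_logic_taut1[OF normal_logic_K, of "Imp m \<phi>" "Imp m (Neg (Neg \<phi>))"]
  by (auto simp: decides_def tautology_def)

lemma decides_Conj: "decides m \<phi> \<Longrightarrow> decides m \<psi> \<Longrightarrow> decides m (Conj \<phi> \<psi>)"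
  using normal_logic_taut2[OF normal_logic_K, of "Imp m \<phi>" "Imp m \<psi>" "Imp m (Conj \<phi> \<psi>)"]
    normal_logic_taut1[OF normal_logic_K, of "Imp m (Neg \<phi>)" "Imp m (Neg (Conj \<phi> \<psi>))"]
    normal_logic_taut1[OF normal_logic_K, of "Imp m (Neg \<psi>)" "Imp m (Neg (Conj \<phi> \<psi>))"]
  by (auto simp: decides_def tautology_def)

lemma decides_cong:
  assumes "decides m \<phi>" "tautology (Iff \<phi> \<psi>)"
  shows "decides m \<psi>"
  using assms normal_logic_taut1[OF normal_logic_K, of "Imp m \<phi>" "Imp m \<psi>"]
    normal_logic_taut1[OF normal_logic_K, of "Imp m (Neg \<phi>)" "Imp m (Neg \<psi>)"]
  by (auto simp: decides_def tautology_def Iff_def)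

lemma decides_Disj:
  assumes "decides m \<phi>" "decides m \<psi>"
  shows "decides m (Disj \<phi> \<psi>)"
  by (rule decides_cong[OF decides_Neg[OF decides_Conj[OF assms[THEN decides_Neg]]]])
    (auto simp: tautology_def Iff_def)

lemma decides_Imp:
  assumes "decides m \<phi>" "decides m \<psi>"
  shows "decides m (Imp \<phi> \<psi>)"
  by (rule decides_cong[OF decides_Disj[OF decides_Neg[OF assms(1)] assms(2)]])
    (auto simp: tautology_def Iff_def)

lemmas decides_intros =
  decides_Bot decides_Top decides_Neg decides_Conj decides_Disj decides_Imp

lemma signed_conjs_decides: "m \<in> set (signed_conjs \<phi>s) \<Longrightarrow> \<phi> \<in> set \<phi>s \<Longrightarrow> decides m \<phi>"
  using signed_conjs_decide normal_logic_taut[OF normal_logic_K] unfolding decides_def by blast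

lemma decides_strengthen:
  assumes "decides m \<phi>" "tautology (Imp m' m)"
  shows "decides m' \<phi>"
  using assms normal_logic_taut1[OF normal_logic_K, of "Imp m \<phi>" "Imp m' \<phi>"]
    normal_logic_taut1[OF normal_logic_K, of "Imp m (Neg \<phi>)" "Imp m' (Neg \<phi>)"]
  by (auto simp: decides_def tautology_def)

text \<open>Induction on the level, then on the formula. At level 0 the diamond case is excluded by
  the degree. At level \<open>Suc d\<close> variables are settled by \<open>a\<close>, diamonds of
  level-\<open>d\<close> minterms by \<open>c\<close>, and the body of a diamond has degree at most
  \<open>d\<close>, so the outer hypothesis applies to it.\<close>

lemma minterm_decides:
  assumes "m \<in> set (minterm_fms v d)" "\<phi> \<in> forms v d"
  shows "decides m \<phi>"
  using assms
proof (induction d arbitrary: m \<phi>)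
  case 0
  have "vars \<phi> \<subseteq> {..<v}" "modal_degree \<phi> = 0"
    using 0 by (auto simp: forms_def)
  then show ?case
  proof (induction \<phi>)
    case (Var i)
    then show ?case using 0(1) by (auto intro!: signed_conjs_decides)
  qed (auto intro: decides_intros)
next
  case (Suc d)
  obtain a c where m: "m = Conj a c"
    and a: "a \<in> set (signed_conjs (map Var [0..<v]))"
    and c: "c \<in> set (signed_conjs (map Dia (minterm_fms v d)))"
    using Suc.prems(1) by auto
  have "vars \<phi> \<subseteq> {..<v}" "modal_degree \<phi> \<le> Suc d"
    using Suc.prems(2) by (auto simp: forms_def)
  then show ?case
  proof (induction \<phi>)
    case (Var i)
    then have "decides a (Var i)" by (intro signed_conjs_decides[OF a]) auto
    then show ?case by (rule decides_strengthen) (simp add: m tautology_def)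
  next
    case (Dia \<psi>)
    show ?case
    proof (rule decides_Dia)
      show "disj_list (minterm_fms v d) \<in> logic_K"
        by (rule normal_logic_taut[OF normal_logic_K tautology_disj_minterms])
      show "decides \<mu> \<psi>" if "\<mu> \<in> set (minterm_fms v d)" for \<mu>
        using Suc.IH[OF that] Dia.prems by (simp add: forms_def)
      show "decides m (Dia \<mu>)" if "\<mu> \<in> set (minterm_fms v d)" for \<mu>
      proof (rule decides_strengthen)
        show "decides c (Dia \<mu>)" using that by (intro signed_conjs_decides[OF c]) auto
      qed (simp add: m tautology_def)
    qed
  qed (auto intro: decides_intros)
qed

section \<open>Characteristic minmatrices\<close>

lemma CMM_antimono: "S \<subseteq> T \<Longrightarrow> CMM v d T \<subseteq> CMM v d S"
  unfolding CMM_def by blast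

text \<open>Primality of a minterm class. \<open>K_le\<close> ranges over all representatives, so
  failures below \<open>\<phi>\<close> and \<open>\<psi>\<close> may occur at different
  \<open>\<mu>\<close> and \<open>\<nu>\<close>; both are equivalent to the same minterm
  \<open>m\<close>, which decides \<open>\<phi>\<close>.\<close>

lemma K_le_minterm_Disj:
  assumes M: "M \<in> minterms v d" and \<phi>: "\<phi> \<in> forms v d"
    and le: "\<And>\<mu>. \<mu> \<in> M \<Longrightarrow> Imp \<mu> (Disj \<phi> \<psi>) \<in> logic_K"
    and "\<mu> \<in> M" "\<nu> \<in> M" "Imp \<mu> \<phi> \<notin> logic_K"
  shows "Imp \<nu> \<psi> \<in> logic_K"
proof -
  obtain m where m: "m \<in> set (minterm_fms v d)" and M_eq: "M = K_equiv v d `` {m}"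
    using M unfolding minterms_def by (rule quotientE)
  have \<mu>: "Iff m \<mu> \<in> logic_K" and \<nu>: "Iff m \<nu> \<in> logic_K"
    using assms(4,5) by (auto simp: M_eq K_equiv_def)
  have "Imp m \<phi> \<notin> logic_K"
    using normal_logic_taut2[OF normal_logic_K \<mu>, of "Imp m \<phi>" "Imp \<mu> \<phi>"] assms(6)
    by (auto simp: tautology_def Iff_def)
  then have imp: "Imp m (Neg \<phi>) \<in> logic_K"
    using minterm_decides[OF m \<phi>] by (simp add: decides_def)
  show ?thesis
    by (rule normal_logic_taut3[OF normal_logic_K imp \<nu> le[OF assms(5)]])
      (auto simp: tautology_def Iff_def)
qed

lemma CMM_Int:
  assumes S: "normal_logic S" and T: "normal_logic T"
  shows "CMM v d (S \<inter> T) = CMM v d S \<union> CMM v d T"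
proof
  show "CMM v d S \<union> CMM v d T \<subseteq> CMM v d (S \<inter> T)"
    using CMM_antimono[of "S \<inter> T" S] CMM_antimono[of "S \<inter> T" T] by blast
  show "CMM v d (S \<inter> T) \<subseteq> CMM v d S \<union> CMM v d T"
  proof
    fix M
    assume M: "M \<in> CMM v d (S \<inter> T)"
    have disj: "M \<in> minterms v d \<and> (\<forall>\<mu>\<in>M. Imp \<mu> (Disj \<phi> \<psi>) \<in> logic_K)"
      if "\<phi> \<in> S" "\<psi> \<in> T" "\<phi> \<in> forms v d" "\<psi> \<in> forms v d" for \<phi> \<psi>
    proof -
      let ?X = "K_equiv v d `` {Disj \<phi> \<psi>}"
      have forms: "Disj \<phi> \<psi> \<in> forms v d"
        using that by (auto simp: forms_def)
      have "Disj \<phi> \<psi> \<in> S" "Disj \<phi> \<psi> \<in> T"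
        by (rule normal_logic_taut1[OF S \<open>\<phi> \<in> S\<close>] normal_logic_taut1[OF T \<open>\<psi> \<in> T\<close>],
            simp add: tautology_def)+
      \<comment> \<open>\<open>L\<close> contains \<open>logic_K\<close>, so it contains the whole
        equivalence class of each of its theorems.\<close>
      moreover have "\<chi> \<in> L" if "Disj \<phi> \<psi> \<in> L" "normal_logic L" "\<chi> \<in> ?X" for \<chi> L
      proof -
        have iff: "Iff (Disj \<phi> \<psi>) \<chi> \<in> L"
          using that logic_K_least by (auto simp: K_equiv_def)
        show ?thesis
          by (rule normal_logic_taut2[OF that(2) iff that(1)])
            (auto simp: tautology_def Iff_def)
      qed
      ultimately have "?X \<subseteq> S \<inter> T" using S T by blast
      moreover have "?X \<in> K_alg v d"
        unfolding K_alg_def using forms by (rule quotientI)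
      ultimately have "M \<in> minterms_below v d ?X"
        using M unfolding CMM_def by blast
      moreover have "Disj \<phi> \<psi> \<in> ?X"
        using forms normal_logic_taut[OF normal_logic_K, of "Iff (Disj \<phi> \<psi>) (Disj \<phi> \<psi>)"]
        by (simp add: K_equiv_def tautology_def Iff_def)
      ultimately show ?thesis
        unfolding minterms_below_def K_le_def by blast
    qed
    have Top: "Top \<in> L" if "normal_logic L" for L
      using normal_logic_taut[OF that] by (simp add: tautology_def)
    \<comment> \<open>\<open>Top\<close> is a theorem of both logics, so the intersection defining
      the minmatrix has a member to bound \<open>M\<close>.\<close>
    have minterm: "M \<in> minterms v d"
      using disj[of Top Top] Top S T by (simp add: forms_def)
    have class_forms: "\<phi> \<in> forms v d" if "X \<in> K_alg v d" "\<phi> \<in> X" for X \<phi>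
      using that by (auto simp: K_alg_def quotient_def K_equiv_def)
    show "M \<in> CMM v d S \<union> CMM v d T"
    proof (rule ccontr)
      assume "M \<notin> CMM v d S \<union> CMM v d T"
      then obtain X Y where "X \<in> K_alg v d" "X \<subseteq> S" "\<not> K_le M X"
          and "Y \<in> K_alg v d" "Y \<subseteq> T" "\<not> K_le M Y"
        using minterm unfolding CMM_def minterms_below_def by blast
      then obtain \<mu> \<phi> \<nu> \<psi> where *: "\<mu> \<in> M" "\<nu> \<in> M" "\<phi> \<in> S" "\<psi> \<in> T"
          "\<phi> \<in> forms v d" "\<psi> \<in> forms v d" "Imp \<mu> \<phi> \<notin> logic_K" "Imp \<nu> \<psi> \<notin> logic_K"
        using class_forms unfolding K_le_def by blast
      then show False
        using K_le_minterm_Disj[OF minterm, of \<phi> \<psi> \<mu> \<nu>] disj[of \<phi> \<psi>] by blast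
    qed
  qed
qed

section \<open>The order structure of the family of minmatrices\<close>

lemma CMMs_Un: "A \<in> CMMs v d \<Longrightarrow> B \<in> CMMs v d \<Longrightarrow> A \<union> B \<in> CMMs v d"
  using CMM_Int normal_logic_Int unfolding CMMs_def by blast

text \<open>The class of \<open>Top\<close> lies in \<open>S\<close>, so the intersection in
  \<open>CMM\<close> is over a nonempty family and does not degenerate to
  \<open>UNIV\<close>.\<close>

lemma CMM_subset_minterms:
  assumes "normal_logic S"
  shows "CMM v d S \<subseteq> minterms v d"
proof -
  let ?X = "K_equiv v d `` {Top}"
  have "Top \<in> S"
    using normal_logic_taut[OF assms] by (simp add: tautology_def)
  then have "\<chi> \<in> S" if "\<chi> \<in> ?X" for \<chi>
    using that logic_K_least[OF assms] normal_logic_taut2[OF assms, of "Iff Top \<chi>" Top \<chi>]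
    by (auto simp: K_equiv_def tautology_def Iff_def)
  moreover have "?X \<in> K_alg v d"
    unfolding K_alg_def by (rule quotientI) (simp add: forms_def)
  ultimately show ?thesis
    unfolding CMM_def minterms_below_def by blast
qed

lemma finite_CMMs: "finite (CMMs v d)"
proof (rule finite_subset)
  show "CMMs v d \<subseteq> Pow (minterms v d)"
    using CMM_subset_minterms unfolding CMMs_def by blast
  show "finite (Pow (minterms v d))"
    by (simp add: minterms_def quotient_def)
qed

lemma CMMs_Union:
  assumes "finite F" "F \<noteq> {}" "F \<subseteq> CMMs v d"
  shows "\<Union>F \<in> CMMs v d"
  using assms by (induction F rule: finite_ne_induct) (auto intro: CMMs_Un)

text \<open>The inconsistent logic contains every other and \<open>CMM\<close> reverses inclusion.
  This provides a common lower bound of any two minmatrices.\<close>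

lemma CMM_UNIV_least: "A \<in> CMMs v d \<Longrightarrow> CMM v d UNIV \<subseteq> A"
  using CMM_antimono unfolding CMMs_def by blast

theorem theorem1:
  fixes v d :: nat and A B :: "fm set set"
  assumes "A \<in> CMMs v d" and "B \<in> CMMs v d"
  shows "(A \<union> B \<in> CMMs v d \<and> isLub (CMMs v d) {A, B} (A \<union> B)) \<and>
         ((\<exists>G. isGlb (CMMs v d) {A, B} G) \<and>
          (\<forall>G. isGlb (CMMs v d) {A, B} G \<longrightarrow> G \<subseteq> A \<inter> B))"
proof (intro conjI)
  show Un: "A \<union> B \<in> CMMs v d"
    using assms by (rule CMMs_Un)
  show "isLub (CMMs v d) {A, B} (A \<union> B)"
    using Un by (auto simp: isLub_def isUb_def leastP_def setle_def setge_def)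
  show "\<forall>G. isGlb (CMMs v d) {A, B} G \<longrightarrow> G \<subseteq> A \<inter> B"
    by (auto simp: isGlb_def isLb_def greatestP_def setle_def setge_def)
  \<comment> \<open>All common lower bounds. The union of this finite nonempty family is a minmatrix
    still contained in \<open>A\<close> and \<open>B\<close>, hence the greatest of them.\<close>
  let ?F = "{C \<in> CMMs v d. C \<subseteq> A \<and> C \<subseteq> B}"
  have "CMM v d UNIV \<in> ?F"
    using assms CMM_UNIV_least normal_logic_UNIV by (auto simp: CMMs_def)
  then have "\<Union>?F \<in> CMMs v d"
    using finite_CMMs by (intro CMMs_Union) auto
  then have "isGlb (CMMs v d) {A, B} (\<Union>?F)"
    by (auto simp: isGlb_def isLb_def greatestP_def setle_def setge_def)
  then show "\<exists>G. isGlb (CMMs v d) {A, B} G" ..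
qed

end
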